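(* Let $n\geq 5$. For every $j\in\mathbb{Z}$ and every directed spanning tree $\overrightarrow{G}$ of $\overrightarrow{C_n^2}$ rooted by $v_j$, there exists a unique nontrivial weakly connected spanning closed subgraph $\overrightarrow{H}$ of $\overrightarrow{C_n^2}$ such that $E(\overrightarrow{G})\subseteq E(\overrightarrow{H})$, and such $\overrightarrow{H}$ is of the form $\overrightarrow{S_{n,k,j'}}$ with $0\leq k\leq\lceil\frac{n-2}{2}\rceil$, $0\leq j'\leq n-1$. More precisely, for every $j\in\mathbb{Z}$, \[ T_{\overrightarrow{C_n^2},v_j}=\bigcup_{k=0}^{\lceil\frac{n-2}{2}\rceil}T_{\overrightarrow{S_{n,k,j}},v_j}, \] and this union is disjoint.
   Context: For $n\geq 5$, the directed square cycle $\overrightarrow{C_n^2}$ has vertex set $\mathbb{Z}_n$, writing $v_i=i+n\mathbb{Z}$ for $i\in\mathbb{Z}$ (indices modulo $n$), and edges $e_i=(v_i,v_{i+1})$ (frames) and $f_i=(v_i,v_{i+2})$ (windows), $i\in\mathbb{Z}$. A spanning subgraph has vertex set $\mathbb{Z}_n$ and a subset of the edges; it is weakly connected if its underlying undirected graph is connected. The triangle $T_i$ is $\{e_i,e_{i+1},f_i\}$; a subgraph $\overrightarrow{G}$ is closed if for every $i$, $|T_i\cap E(\overrightarrow{G})|\leq 1$ or $T_i\subseteq E(\overrightarrow{G})$. The trivial weakly connected spanning closed subgraphs are $\overrightarrow{C_n^2}$ itself and, when $n$ is odd, the subgraph whose edges are all the windows $f_0,\dots,f_{n-1}$; all others are nontrivial.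 For integers $j,k$ with $0\leq k\leq\lceil\frac{n-2}{2}\rceil$, $\overrightarrow{S_{n,k,j}}$ is the spanning subgraph of $\overrightarrow{C_n^2}$ with edge set $E(\overrightarrow{C_n^2})\setminus\big(\{f_{j-2},f_{j+2k-1}\}\cup\{e_{j-1},e_j,\dots,e_{j+2k-1}\}\big)$. For a directed graph $\overrightarrow{G}$ and vertex $u$, a directed spanning tree rooted by $u$ is a spanning subgraph whose underlying undirected graph is connected, which has no closed paths, in which every vertex $v\neq u$ has in-degree $1$, and in which every vertex $v\neq u$ is reachable from $u$ by a directed path; $T_{\overrightarrow{G},u}$ denotes the set of all such trees (viewed as edge sets). *)

theory Defs
  imports Complex_Main "HOL-Library.Disjoint_Sets" "Graph_Theory.Digraph_Component"
begin

text \<open>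
  The residue class of \<open>i\<close> modulo \<open>n\<close> is represented by its least nonnegative element.
  For \<open>n \<ge> 3\<close> frames and windows are pairwise distinct arcs without parallels, so digraphs whose
  arcs are pairs of vertices suffice.
\<close>

definition vtx :: "nat \<Rightarrow> int \<Rightarrow> int" where
  "vtx n i = i mod int n"

definition frame :: "nat \<Rightarrow> int \<Rightarrow> int \<times> int" where
  "frame n i = (vtx n i, vtx n (i + 1))"

definition window :: "nat \<Rightarrow> int \<Rightarrow> int \<times> int" where
  "window n i = (vtx n i, vtx n (i + 2))"

definition square_cycle :: "nat \<Rightarrow> int pair_pre_digraph" where
  "square_cycle n = \<lparr> pverts = range (vtx n), parcs = range (frame n) \<union> range (window n) \<rparr>"

definition triangle :: "nat \<Rightarrow> int \<Rightarrow> (int \<times> int) set" where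
  "triangle n i = {frame n i, frame n (i + 1), window n i}"

definition closed_subgraph :: "nat \<Rightarrow> int pair_pre_digraph \<Rightarrow> bool" where
  "closed_subgraph n H \<longleftrightarrow>
    (\<forall>i. card (triangle n i \<inter> parcs H) \<le> 1 \<or> triangle n i \<subseteq> parcs H)"

text \<open>\<open>Digraph_Component.connected\<close> is connectedness of the underlying undirected graph.\<close>

definition wcsc_subgraph :: "nat \<Rightarrow> int pair_pre_digraph \<Rightarrow> bool" where
  "wcsc_subgraph n H \<longleftrightarrow>
    spanning (with_proj H) (with_proj (square_cycle n)) \<and>
    Digraph_Component.connected (with_proj H) \<and>
    closed_subgraph n H"

definition window_subgraph :: "nat \<Rightarrow> int pair_pre_digraph" where
  "window_subgraph n = \<lparr> pverts = range (vtx n), parcs = range (window n) \<rparr>"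

definition nontrivial_wcsc_subgraph :: "nat \<Rightarrow> int pair_pre_digraph \<Rightarrow> bool" where
  "nontrivial_wcsc_subgraph n H \<longleftrightarrow>
    wcsc_subgraph n H \<and> H \<noteq> square_cycle n \<and> \<not> (odd n \<and> H = window_subgraph n)"

definition S_graph :: "nat \<Rightarrow> int \<Rightarrow> int \<Rightarrow> int pair_pre_digraph" where
  "S_graph n k j = \<lparr> pverts = range (vtx n),
     parcs = parcs (square_cycle n) -
       ({window n (j - 2), window n (j + 2 * k - 1)} \<union> frame n ` {j - 1 .. j + 2 * k - 1}) \<rparr>"

text \<open>
  The library's \<open>spanning_tree T G\<close> says that \<open>T\<close> is a spanning subgraph of \<open>G\<close> whose
  underlying undirected graph is connected and which has no directed cycle. Together with the
  in-degree condition this also excludes cycles of the underlying undirected graph.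
\<close>

definition directed_spanning_tree ::
    "'a pair_pre_digraph \<Rightarrow> 'a pair_pre_digraph \<Rightarrow> 'a \<Rightarrow> bool" where
  "directed_spanning_tree T G u \<longleftrightarrow>
    u \<in> pverts G \<and>
    spanning_tree (with_proj T) (with_proj G) \<and>
    (\<forall>v \<in> pverts T. v \<noteq> u \<longrightarrow> in_degree (with_proj T) v = 1) \<and>
    (\<forall>v \<in> pverts T. v \<noteq> u \<longrightarrow> u \<rightarrow>\<^sup>*\<^bsub>with_proj T\<^esub> v)"

definition directed_spanning_trees :: "'a pair_pre_digraph \<Rightarrow> 'a \<Rightarrow> ('a \<times> 'a) set set" where
  "directed_spanning_trees G u = {parcs T | T. directed_spanning_tree T G u}"

end

theory Submission
  imports Defs
begin

text \<open>
  Let \<open>T\<close> be a directed spanning tree rooted by \<open>v\<^sub>j\<close>, and follow windows from the root,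
  \<open>v\<^sub>j, v\<^bsub>j+2\<^esub>, \<dots>\<close>, up to the first vertex \<open>v\<^bsub>j+2k\<^esub>\<close> whose outgoing frame is in \<open>T\<close>. Since every
  vertex other than the root has exactly one incoming arc, this forces \<open>T\<close> into \<open>S\<^bsub>n,k,j\<^esub>\<close>.
  Starting from the frame \<open>e\<^bsub>j+2k\<^esub>\<close>, the incoming arc of the next vertex always completes
  a triangle, so every closed subgraph containing \<open>T\<close> contains \<open>S\<^bsub>n,k,j\<^esub>\<close>. Adding one more
  arc to \<open>S\<^bsub>n,k,j\<^esub>\<close> and closing up gives all frames, hence everything, except that for
  \<open>2k = n - 1\<close> adding the last missing window gives the subgraph of all windows.
\<close>

section \<open>Indices modulo \<open>n\<close>\<close>

lemma vtx_eq_iff: "vtx n i = vtx n i' \<longleftrightarrow> int n dvd i - i'"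
  by (simp add: vtx_def mod_eq_dvd_iff)

lemma vtx_add_cong: "vtx n i = vtx n i' \<Longrightarrow> vtx n (i + d) = vtx n (i' + d)"
  by (simp add: vtx_eq_iff)

text \<open>A nonzero multiple of \<open>n\<close> has absolute value at least \<open>n\<close>.
  Vertex equalities thus become integer equalities within one period.\<close>

lemma vtx_eq_iff_close: "\<bar>i - i'\<bar> < int n \<Longrightarrow> vtx n i = vtx n i' \<longleftrightarrow> i = i'"
  unfolding vtx_eq_iff using dvd_imp_le_int[of "i - i'" "int n"] by fastforce

lemma frame_eq_iff: "frame n i = frame n i' \<longleftrightarrow> vtx n i = vtx n i'"
  by (auto simp: frame_def intro: vtx_add_cong)

lemma window_eq_iff: "window n i = window n i' \<longleftrightarrow> vtx n i = vtx n i'"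
  by (auto simp: window_def intro: vtx_add_cong)

lemma frame_neq_window:
  assumes "n \<ge> 2"
  shows "frame n i \<noteq> window n i'"
proof
  assume "frame n i = window n i'"
  then have "vtx n i = vtx n i'" "vtx n (i + 1) = vtx n (i' + 2)"
    by (auto simp: frame_def window_def)
  then have "vtx n (i' + 1) = vtx n (i' + 2)"
    using vtx_add_cong[of n i i' 1] by simp
  then show False
    using assms by (simp add: vtx_eq_iff_close)
qed

text \<open>The start \<open>b\<close> is left free because membership in
  \<open>S_graph n k j\<close> has a simple description only over a period starting near
  \<open>j\<close>.\<close>

lemma vtx_representative:
  assumes "n > 0"
  obtains i' where "b \<le> i'" "i' < b + int n" "vtx n i' = vtx n i"
proof
  show "b \<le> b + (i - b) mod int n" "b + (i - b) mod int n < b + int n"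
    using assms by simp_all
  show "vtx n (b + (i - b) mod int n) = vtx n i"
    by (simp add: vtx_def mod_simps)
qed

lemma all_frames_iff:
  assumes "n > 0"
  shows "(\<forall>i. P (frame n i)) \<longleftrightarrow> (\<forall>i. b \<le> i \<and> i < b + int n \<longrightarrow> P (frame n i))"
  using vtx_representative[OF assms] frame_eq_iff by metis

lemma all_windows_iff:
  assumes "n > 0"
  shows "(\<forall>i. P (window n i)) \<longleftrightarrow> (\<forall>i. b \<le> i \<and> i < b + int n \<longrightarrow> P (window n i))"
  using vtx_representative[OF assms] window_eq_iff by metis

lemma square_cycle_simps [simp]:
  "pverts (square_cycle n) = range (vtx n)"
  "parcs (square_cycle n) = range (frame n) \<union> range (window n)"
  by (simp_all add: square_cycle_def)

text \<open>Two starts are kept apart because \<open>S_graph\<close> is described from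
  \<open>j - 1\<close> on for frames and from \<open>j - 2\<close> on for windows.\<close>

lemma subset_square_cycle_iff:
  assumes "n > 0" "A \<subseteq> parcs (square_cycle n)"
  shows "A \<subseteq> B \<longleftrightarrow>
    (\<forall>i. b \<le> i \<and> i < b + int n \<longrightarrow> frame n i \<in> A \<longrightarrow> frame n i \<in> B) \<and>
    (\<forall>i. c \<le> i \<and> i < c + int n \<longrightarrow> window n i \<in> A \<longrightarrow> window n i \<in> B)"
proof -
  have "A \<subseteq> B \<longleftrightarrow> (\<forall>i. frame n i \<in> A \<longrightarrow> frame n i \<in> B) \<and>
      (\<forall>i. window n i \<in> A \<longrightarrow> window n i \<in> B)"
    using assms(2) by auto
  then show ?thesis
    using all_frames_iff[OF assms(1), of "\<lambda>x. x \<in> A \<longrightarrow> x \<in> B" b]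
      all_windows_iff[OF assms(1), of "\<lambda>x. x \<in> A \<longrightarrow> x \<in> B" c] by simp
qed

section \<open>Spanning and closed subgraphs\<close>

lemma spanning_with_proj_iff:
  "spanning (with_proj H) (with_proj G) \<longleftrightarrow>
    pverts H = pverts G \<and> parcs H \<subseteq> parcs G \<and> parcs G \<subseteq> pverts G \<times> pverts G"
  unfolding spanning_def subgraph_def compatible_def wf_digraph_def
  by (auto 4 4)

lemma square_cycle_wf: "parcs (square_cycle n) \<subseteq> pverts (square_cycle n) \<times> pverts (square_cycle n)"
  by (auto simp: frame_def window_def)

lemma spanning_square_cycle_iff:
  "spanning (with_proj H) (with_proj (square_cycle n)) \<longleftrightarrow>
    pverts H = range (vtx n) \<and> parcs H \<subseteq> parcs (square_cycle n)"
  using square_cycle_wf[of n] by (auto simp only: spanning_with_proj_iff square_cycle_simps)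

lemma card_triple_Int_le_1_iff:
  assumes "a \<noteq> b" "a \<noteq> c" "b \<noteq> c"
  shows "card ({a, b, c} \<inter> X) \<le> 1 \<longleftrightarrow>
    \<not> (a \<in> X \<and> b \<in> X) \<and> \<not> (a \<in> X \<and> c \<in> X) \<and> \<not> (b \<in> X \<and> c \<in> X)"
  using assms by (auto simp: Int_insert_left)

lemma closed_subgraph_iff:
  assumes "n \<ge> 2"
  shows "closed_subgraph n H \<longleftrightarrow> (\<forall>i.
    (frame n i \<in> parcs H \<and> frame n (i + 1) \<in> parcs H \<longrightarrow> window n i \<in> parcs H) \<and>
    (frame n i \<in> parcs H \<and> window n i \<in> parcs H \<longrightarrow> frame n (i + 1) \<in> parcs H) \<and>
    (frame n (i + 1) \<in> parcs H \<and> window n i \<in> parcs H \<longrightarrow> frame n i \<in> parcs H))"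
proof -
  have "card (triangle n i \<inter> X) \<le> 1 \<longleftrightarrow>
      \<not> (frame n i \<in> X \<and> frame n (i + 1) \<in> X) \<and> \<not> (frame n i \<in> X \<and> window n i \<in> X) \<and>
      \<not> (frame n (i + 1) \<in> X \<and> window n i \<in> X)" for i X
    unfolding triangle_def using assms frame_neq_window[OF assms]
    by (intro card_triple_Int_le_1_iff) (simp_all add: frame_eq_iff vtx_eq_iff_close)
  then show ?thesis
    unfolding closed_subgraph_def triangle_def by simp blast
qed

lemma closed_subgraphD:
  assumes "closed_subgraph n H" "n \<ge> 2"
  shows "frame n i \<in> parcs H \<Longrightarrow> frame n (i + 1) \<in> parcs H \<Longrightarrow> window n i \<in> parcs H"
    and "frame n i \<in> parcs H \<Longrightarrow> window n i \<in> parcs H \<Longrightarrow> frame n (i + 1) \<in> parcs H"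
    and "frame n (i + 1) \<in> parcs H \<Longrightarrow> window n i \<in> parcs H \<Longrightarrow> frame n i \<in> parcs H"
  using assms closed_subgraph_iff by blast+

section \<open>The graphs \<open>S_graph\<close> and the closed subgraphs above them\<close>

lemma S_graph_pverts [simp]: "pverts (S_graph n k j) = range (vtx n)"
  by (simp add: S_graph_def)

lemma S_graph_parcs_subset: "parcs (S_graph n k j) \<subseteq> parcs (square_cycle n)"
  by (auto simp: S_graph_def)

text \<open>The \<open>2 * k + 1\<close> removed frames fill the beginning of the period from
  \<open>j - 1\<close>; since \<open>2 * k < n\<close>, they do not wrap around.\<close>

lemma frame_in_S_graph_iff:
  assumes "n \<ge> 2" "0 \<le> k" "2 * k < int n" "j - 1 \<le> i" "i < j - 1 + int n"
  shows "frame n i \<in> parcs (S_graph n k j) \<longleftrightarrow> j + 2 * k \<le> i"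
proof -
  have "frame n i \<in> frame n ` {j - 1 .. j + 2 * k - 1} \<longleftrightarrow> i \<in> {j - 1 .. j + 2 * k - 1}"
    using assms by (auto simp: frame_eq_iff vtx_eq_iff_close)
  then show ?thesis
    using assms frame_neq_window[OF assms(1)] by (auto simp: S_graph_def)
qed

lemma window_in_S_graph_iff:
  assumes "n \<ge> 2" "0 \<le> k" "2 * k < int n" "j - 2 \<le> i" "i < j - 2 + int n"
  shows "window n i \<in> parcs (S_graph n k j) \<longleftrightarrow> i \<noteq> j - 2 \<and> i \<noteq> j + 2 * k - 1"
proof -
  have "window n i \<noteq> window n (j - 2) \<longleftrightarrow> i \<noteq> j - 2"
    using assms by (simp add: window_eq_iff vtx_eq_iff_close)
  \<comment> \<open>If \<open>2 * k = n - 1\<close>, the two removed windows coincide and this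
    equivalence fails at \<open>i = j - 2\<close>.\<close>
  moreover have "window n i \<noteq> window n (j + 2 * k - 1) \<longleftrightarrow> i \<noteq> j + 2 * k - 1" if "i \<noteq> j - 2"
    using assms that by (auto simp: window_eq_iff vtx_eq_iff_close)
  ultimately show ?thesis
    using frame_neq_window[OF assms(1)] by (auto simp: S_graph_def) metis+
qed

lemma S_graph_vtx_cong:
  assumes "vtx n j = vtx n j'"
  shows "S_graph n k j = S_graph n k j'"
proof -
  have shift: "vtx n (j + d) = vtx n (j' + d)" for d
    using assms by (rule vtx_add_cong)
  \<comment> \<open>Indexing by offsets from the start lets the two intervals be compared term by
    term.\<close>
  have "frame n ` {a - 1 .. a + 2 * k - 1} = (\<lambda>d. frame n (a + d)) ` {- 1 .. 2 * k - 1}" for a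
  proof -
    have "{a - 1 .. a + 2 * k - 1} = (+) a ` {- 1 .. 2 * k - 1}"
      by (simp add: algebra_simps)
    then show ?thesis
      by (simp only: image_image)
  qed
  moreover have "frame n (j + d) = frame n (j' + d)" for d
    by (simp add: frame_eq_iff shift)
  moreover have "window n (j - 2) = window n (j' - 2)"
    "window n (j + 2 * k - 1) = window n (j' + 2 * k - 1)"
    using shift[of "- 2"] shift[of "2 * k - 1"] by (simp_all add: window_eq_iff algebra_simps)
  ultimately show ?thesis
    unfolding S_graph_def by (simp only:)
qed

text \<open>The triangles at \<open>j - 2\<close> and \<open>j + 2 * k - 1\<close> lack the window
  and at least one frame, those strictly between keep only the window, and the others are
  complete.\<close>

lemma S_graph_closed:
  assumes "n \<ge> 2" "0 \<le> k" "2 * k < int n"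
  shows "closed_subgraph n (S_graph n k j)"
  unfolding closed_subgraph_iff[OF assms(1)]
proof
  fix m
  let ?S = "parcs (S_graph n k j)"
  obtain i where i: "j - 2 \<le> i" "i < j - 2 + int n" "vtx n i = vtx n m"
    using vtx_representative[of n "j - 2" m] assms by auto
  have eqs: "frame n m = frame n i" "frame n (m + 1) = frame n (i + 1)" "window n m = window n i"
    using i(3) vtx_add_cong[OF i(3), of 1] by (simp_all add: frame_eq_iff window_eq_iff)
  have F1: "frame n (i + 1) \<in> ?S \<longleftrightarrow> j + 2 * k \<le> i + 1"
    using assms i by (intro frame_in_S_graph_iff) auto
  have W: "window n i \<in> ?S \<longleftrightarrow> i \<noteq> j - 2 \<and> i \<noteq> j + 2 * k - 1"
    using assms i by (intro window_in_S_graph_iff) auto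
  \<comment> \<open>Index \<open>j - 2\<close> precedes the range of the frame description; there
    the window and the next frame are absent, which settles that triangle.\<close>
  have F: "frame n i \<in> ?S \<longleftrightarrow> j + 2 * k \<le> i" if "i \<noteq> j - 2"
    using assms i that by (intro frame_in_S_graph_iff) auto
  show "(frame n m \<in> ?S \<and> frame n (m + 1) \<in> ?S \<longrightarrow> window n m \<in> ?S) \<and>
    (frame n m \<in> ?S \<and> window n m \<in> ?S \<longrightarrow> frame n (m + 1) \<in> ?S) \<and>
    (frame n (m + 1) \<in> ?S \<and> window n m \<in> ?S \<longrightarrow> frame n m \<in> ?S)"
    unfolding eqs F1 W using F assms by (cases "i = j - 2") auto
qed

lemma S_graph_nontrivial:
  "S_graph n k j \<noteq> square_cycle n" "S_graph n k j \<noteq> window_subgraph n"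
proof -
  have "window n (j - 2) \<notin> parcs (S_graph n k j)"
    by (simp add: S_graph_def)
  then show "S_graph n k j \<noteq> square_cycle n" "S_graph n k j \<noteq> window_subgraph n"
    by (auto simp: window_subgraph_def)
qed

text \<open>
  Consecutive missing frames of \<open>S_graph n k j\<close> span a triangle whose window is present, so one
  of them forces all the others.
\<close>

lemma closed_above_S_graph_frame:
  assumes "n \<ge> 2" "0 \<le> k" "2 * k < int n"
    and H: "closed_subgraph n H" "parcs (S_graph n k j) \<subseteq> parcs H"
    and m: "frame n m \<in> parcs H" "frame n m \<notin> parcs (S_graph n k j)"
  shows "parcs (square_cycle n) \<subseteq> parcs H"
proof -
  obtain i where i: "j - 1 \<le> i" "i < j - 1 + int n" "vtx n i = vtx n m"
    using vtx_representative[of n "j - 1" m] assms(1) by auto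
  then have Fi: "frame n i \<in> parcs H" "i \<le> j + 2 * k - 1"
    using m frame_in_S_graph_iff[OF assms(1-3) i(1,2)] frame_eq_iff by (metis, force)
  have W: "window n l \<in> parcs H" if "j - 1 \<le> l" "l < j + 2 * k - 1" for l
    using that window_in_S_graph_iff[OF assms(1-3), of j l] H(2) assms by auto
  have up: "frame n l \<in> parcs H" if "i \<le> l" "l \<le> j + 2 * k - 1" for l
    using that
  proof (induction l rule: int_ge_induct)
    case (step l)
    then show ?case
      using W[of l] i(1) closed_subgraphD(2)[OF H(1) assms(1), of l] by auto
  qed (use Fi in simp)
  have down: "frame n l \<in> parcs H" if "l \<le> i" "j - 1 \<le> l" for l
    using that
  proof (induction l rule: int_le_induct)
    case (step l)
    then have "window n (l - 1) \<in> parcs H"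
      using Fi(2) by (intro W) auto
    then show ?case
      using step closed_subgraphD(3)[OF H(1) assms(1), of "l - 1"] by auto
  qed (use Fi in simp)
  have "frame n l \<in> parcs H" if "j - 1 \<le> l \<and> l < j - 1 + int n" for l
    using up[of l] down[of l] frame_in_S_graph_iff[OF assms(1-3), of j l] H(2) that
    by (cases "l \<le> i"; cases "l \<le> j + 2 * k - 1") auto
  then have F: "frame n l \<in> parcs H" for l
    using all_frames_iff[of n "\<lambda>x. x \<in> parcs H" "j - 1"] assms(1) by auto
  then have "window n l \<in> parcs H" for l
    using closed_subgraphD(1)[OF H(1) assms(1)] by blast
  with F show ?thesis
    by auto
qed

text \<open>An additional window must be one of the removed ones. If \<open>S_graph\<close> retains
  a frame, a retained frame in the triangle of that window forces a removed frame; otherwise all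
  windows are now present.\<close>

lemma closed_above_S_graph_trivial:
  assumes "n \<ge> 2" "0 \<le> k" "2 * k < int n"
    and H: "closed_subgraph n H" "parcs (S_graph n k j) \<subset> parcs H" "parcs H \<subseteq> parcs (square_cycle n)"
  shows "parcs H = parcs (square_cycle n) \<or> odd n \<and> parcs H = range (window n)"
proof (cases "\<exists>m. frame n m \<in> parcs H - parcs (S_graph n k j)")
  case True
  then show ?thesis
    using closed_above_S_graph_frame[OF assms(1-4), of j] H by blast
next
  case False
  let ?S = "parcs (S_graph n k j)"
  obtain a where "a \<in> parcs H - ?S"
    using H(2) by auto
  then obtain m where m: "window n m \<in> parcs H" "window n m \<notin> ?S"
    using False H(3) by auto
  obtain i where i: "j - 2 \<le> i" "i < j - 2 + int n" "vtx n i = vtx n m"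
    using vtx_representative[of n "j - 2" m] assms(1) by auto
  then have Wi: "window n i \<in> parcs H" "i = j - 2 \<or> i = j + 2 * k - 1"
    using m window_in_S_graph_iff[OF assms(1-3) i(1,2)] window_eq_iff by metis+
  show ?thesis
  proof (cases "2 * k = int n - 1")
    case True
    \<comment> \<open>The alternative \<open>j + 2 * k - 1\<close> equals \<open>j - 2 + n\<close>,
      just beyond the period of \<open>i\<close>.\<close>
    have "i = j - 2"
      using Wi(2) i True by auto
    have noframe: "\<forall>l. frame n l \<notin> ?S"
      using frame_in_S_graph_iff[OF assms(1-3)] True assms(1)
      by (subst all_frames_iff[of n _ "j - 1"]) auto
    have "\<forall>l. window n l \<in> parcs H"
      using window_in_S_graph_iff[OF assms(1-3)] True assms(1) H(2) Wi(1) \<open>i = j - 2\<close>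
      by (subst all_windows_iff[of n _ "j - 2"]) auto
    with noframe False H(3) have "parcs H = range (window n)"
      by auto
    moreover have "odd n"
      using True by presburger
    ultimately show ?thesis
      by simp
  next
    case k: False
    have "\<exists>l. frame n l \<in> parcs H \<and> frame n l \<notin> ?S"
      using Wi(2)
    proof
      assume "i = j - 2"
      \<comment> \<open>The shift by \<open>n\<close> moves the index into the range of the frame
        description, where \<open>2 * k \<le> n - 2\<close> makes it a retained frame.\<close>
      have "frame n (j - 2) = frame n (j - 2 + int n)"
        by (simp add: frame_eq_iff vtx_eq_iff)
      then have "frame n (j - 2) \<in> ?S"
        using frame_in_S_graph_iff[OF assms(1-3), of j "j - 2 + int n"] assms k by auto
      then have "frame n (j - 1) \<in> parcs H"
        using closed_subgraphD(2)[OF H(1) assms(1), of "j - 2"] Wi(1) H(2) \<open>i = j - 2\<close> by auto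
      moreover have "frame n (j - 1) \<notin> ?S"
        using frame_in_S_graph_iff[OF assms(1-3), of j "j - 1"] assms by auto
      ultimately show ?thesis
        by blast
    next
      assume "i = j + 2 * k - 1"
      have "frame n (j + 2 * k) \<in> ?S"
        using frame_in_S_graph_iff[OF assms(1-3), of j "j + 2 * k"] assms k by auto
      then have "frame n (j + 2 * k - 1) \<in> parcs H"
        using closed_subgraphD(3)[OF H(1) assms(1), of "j + 2 * k - 1"] Wi(1) H(2)
          \<open>i = j + 2 * k - 1\<close> by auto
      moreover have "frame n (j + 2 * k - 1) \<notin> ?S"
        using frame_in_S_graph_iff[OF assms(1-3), of j "j + 2 * k - 1"] assms by auto
      ultimately show ?thesis
        by blast
    qed
    with False show ?thesis
      by blast
  qed
qed

section \<open>Directed spanning trees\<close>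

text \<open>A directed path from the root to \<open>v\<close>, prolonged by this arc, would be a
  closed walk and so yield a directed cycle.\<close>

lemma directed_spanning_tree_no_arc_to_root:
  assumes "directed_spanning_tree T G u" "(v, u) \<in> parcs T"
  shows False
proof -
  have T: "spanning (with_proj T) (with_proj G)" "forest (with_proj T)"
    and reach: "\<And>w. w \<in> pverts T \<Longrightarrow> w \<noteq> u \<Longrightarrow> u \<rightarrow>\<^sup>*\<^bsub>with_proj T\<^esub> w"
    using assms(1) by (auto simp: directed_spanning_tree_def spanning_tree_def tree_def)
  interpret wf_digraph "with_proj T"
    using T(1) by (simp add: spanning_def subgraph_def)
  have v: "v \<in> pverts T" "u \<in> pverts T"
    using wellformed[of "(v, u)"] assms(2) by auto
  have "u \<rightarrow>\<^sup>*\<^bsub>with_proj T\<^esub> v"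
    using reach v by (cases "v = u") auto
  then obtain p where "awalk u p v"
    by (auto simp: reachable_awalk)
  then have "awalk u (p @ [(v, u)]) u"
    using assms(2) v by (auto simp: awalk_append_iff awalk_Cons_iff awalk_Nil_iff)
  then have "closed_w (p @ [(v, u)])"
    by (auto simp: closed_w_def)
  then have "\<exists>p. cycle p"
    by (metis closed_w_imp_cycle)
  with T(2) show False
    by (simp add: forest_def)
qed

text \<open>Only the root membership and the spanning condition mention the ambient graph; the rest
  concerns \<open>T\<close> alone.\<close>

lemma directed_spanning_tree_subset:
  assumes "directed_spanning_tree T G u" "parcs T \<subseteq> parcs H" "pverts H = pverts G"
    "parcs H \<subseteq> parcs G"
  shows "directed_spanning_tree T H u"
  using assms unfolding directed_spanning_tree_def spanning_tree_def spanning_with_proj_iff by auto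

lemma directed_spanning_tree_mono:
  assumes "directed_spanning_tree T H u" "pverts H = pverts G"
    "parcs H \<subseteq> parcs G" "parcs G \<subseteq> pverts G \<times> pverts G"
  shows "directed_spanning_tree T G u"
  using assms unfolding directed_spanning_tree_def spanning_tree_def spanning_with_proj_iff by auto

section \<open>Trees of the square cycle and the closed subgraphs containing them\<close>

locale square_cycle_tree =
  fixes n :: nat and j :: int and T :: "int pair_pre_digraph"
  assumes n_ge: "n \<ge> 5"
    and tree: "directed_spanning_tree T (square_cycle n) (vtx n j)"
begin

lemma n_ge_2: "n \<ge> 2"
  using n_ge by simp

lemma pverts_T: "pverts T = range (vtx n)" and parcs_T: "parcs T \<subseteq> parcs (square_cycle n)"
  using tree by (auto simp: directed_spanning_tree_def spanning_tree_def spanning_with_proj_iff)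

lemma connected_T: "Digraph_Component.connected (with_proj T)"
  using tree by (auto simp: directed_spanning_tree_def spanning_tree_def tree_def)

lemma arc_to_root: "frame n (j - 1) \<notin> parcs T" "window n (j - 2) \<notin> parcs T"
  using directed_spanning_tree_no_arc_to_root[OF tree] by (auto simp: frame_def window_def)

text \<open>In this range \<open>v_i\<close> is not the root, so its in-degree is 1, and the square
  cycle offers it only these two incoming arcs.\<close>

lemma in_arc:
  assumes "j < i" "i < j + int n"
  shows "frame n (i - 1) \<in> parcs T \<longleftrightarrow> window n (i - 2) \<notin> parcs T"
proof -
  have "vtx n i \<noteq> vtx n j"
    using assms by (simp add: vtx_eq_iff_close)
  then have "card {e \<in> parcs T. snd e = vtx n i} = 1"
    using tree pverts_T by (auto simp: directed_spanning_tree_def in_degree_def in_arcs_def)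
  moreover have "{e \<in> parcs T. snd e = vtx n i} = {frame n (i - 1), window n (i - 2)} \<inter> parcs T"
  proof -
    have F: "frame n m = frame n (i - 1)" if "snd (frame n m) = vtx n i" for m
      using that vtx_add_cong[of n "m + 1" i "- 1"] by (simp add: frame_eq_iff) (simp add: frame_def)
    have W: "window n m = window n (i - 2)" if "snd (window n m) = vtx n i" for m
      using that vtx_add_cong[of n "m + 2" i "- 2"] by (simp add: window_eq_iff) (simp add: window_def)
    have "e = frame n (i - 1) \<or> e = window n (i - 2)" if "e \<in> parcs T" "snd e = vtx n i" for e
    proof -
      consider m where "e = frame n m" | m where "e = window n m"
        using \<open>e \<in> parcs T\<close> parcs_T by auto
      then show ?thesis
        using F W \<open>snd e = vtx n i\<close> by cases blast+
    qed
    moreover have "snd (frame n (i - 1)) = vtx n i" "snd (window n (i - 2)) = vtx n i"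
      by (simp_all add: frame_def window_def)
    ultimately show ?thesis
      by blast
  qed
  ultimately show ?thesis
    using frame_neq_window[OF n_ge_2, of "i - 1" "i - 2"]
    by (cases "frame n (i - 1) \<in> parcs T"; cases "window n (i - 2) \<in> parcs T") auto
qed

text \<open>Reachability of every vertex from the root, recast as an induction principle for vertex
  sets.\<close>

lemma reach_induct:
  assumes "vtx n j \<in> X" and step: "\<And>u v. u \<in> X \<Longrightarrow> (u, v) \<in> parcs T \<Longrightarrow> v \<in> X"
  shows "vtx n i \<in> X"
proof (cases "vtx n i = vtx n j")
  case False
  then have "(vtx n j, vtx n i) \<in> rtrancl_on (pverts T) (parcs T)"
    using tree pverts_T by (auto simp: directed_spanning_tree_def reachable_def)
  then show ?thesis
    by (induction rule: rtrancl_on_induct) (use assms in auto)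
qed (use assms in simp)

text \<open>
  Otherwise \<open>{v\<^sub>j, v\<^bsub>j+2\<^esub>, \<dots>, v\<^bsub>j+2i\<^esub>}\<close> has no outgoing arcs, but it does not contain \<open>v\<^bsub>j+1\<^esub>\<close>.
\<close>

lemma window_if_no_frames:
  assumes "0 \<le> i" "2 * i < int n"
    and no_frames: "\<And>l. 0 \<le> l \<Longrightarrow> l \<le> i \<Longrightarrow> frame n (j + 2 * l) \<notin> parcs T"
  shows "window n (j + 2 * i) \<in> parcs T"
proof (rule ccontr)
  assume *: "window n (j + 2 * i) \<notin> parcs T"
  let ?X = "(\<lambda>l. vtx n (j + 2 * l)) ` {0..i}"
  have "vtx n (j + 1) \<in> ?X"
  proof (rule reach_induct)
    show "vtx n j \<in> ?X"
      using assms(1) by (intro image_eqI[of _ _ 0]) auto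
  next
    fix u v
    assume "u \<in> ?X" and uv: "(u, v) \<in> parcs T"
    then obtain l where l: "0 \<le> l" "l \<le> i" "u = vtx n (j + 2 * l)"
      by auto
    consider m where "(u, v) = frame n m" | m where "(u, v) = window n m"
      using uv parcs_T by auto
    then show "v \<in> ?X"
    proof cases
      case 1
      then have "(u, v) = frame n (j + 2 * l)"
        using l(3) by (simp add: frame_eq_iff) (simp add: frame_def)
      then show ?thesis
        using no_frames l uv by metis
    next
      case 2
      then have uv': "(u, v) = window n (j + 2 * l)"
        using l(3) by (simp add: window_eq_iff) (simp add: window_def)
      then have "l \<noteq> i"
        using * uv by metis
      then show ?thesis
        using l uv' by (intro image_eqI[of _ _ "l + 1"]) (auto simp: window_def algebra_simps)
    qed
  qed
  then obtain l where "0 \<le> l" "l \<le> i" "vtx n (j + 1) = vtx n (j + 2 * l)"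
    by auto
  \<comment> \<open>The bound \<open>2 * i < n\<close> turns the vertex equality into an integer
    equality, which parity refutes.\<close>
  moreover have "\<bar>(j + 1) - (j + 2 * l)\<bar> < int n"
    using \<open>0 \<le> l\<close> \<open>l \<le> i\<close> assms(2) n_ge by linarith
  ultimately have "j + 1 = j + 2 * l"
    by (simp add: vtx_eq_iff_close)
  then show False
    by presburger
qed

text \<open>Removed frames at even offsets from \<open>j\<close> are absent by assumption. Those at
  odd offsets compete with a window of \<open>T\<close> for the same head, except that
  \<open>j - 1\<close> leads into the root.\<close>

lemma subset_S_graph_if_no_frames:
  assumes k: "0 \<le> k" "2 * k < int n"
    and no_frames: "\<And>l. 0 \<le> l \<Longrightarrow> l < k \<Longrightarrow> frame n (j + 2 * l) \<notin> parcs T"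
    and last: "2 * k = int n - 1 \<or> frame n (j + 2 * k) \<in> parcs T"
  shows "parcs T \<subseteq> parcs (S_graph n k j)"
proof -
  have "window n (j + 2 * k - 1) \<notin> parcs T"
  proof (cases "2 * k = int n - 1")
    case True
    then have "window n (j + 2 * k - 1) = window n (j - 2)"
      by (simp add: window_eq_iff vtx_eq_iff)
    then show ?thesis
      using arc_to_root by simp
  next
    case False
    then show ?thesis
      using last in_arc[of "j + 2 * k + 1"] k by auto
  qed
  moreover have "j + 2 * k \<le> i" if "j - 1 \<le> i" "frame n i \<in> parcs T" for i
  proof (rule ccontr)
    assume "\<not> j + 2 * k \<le> i"
    obtain l where "i = j + 2 * l \<or> i = j + 2 * l + 1"
      by (metis (no_types, opaque_lifting) add.commute add.left_commute diff_add_cancel oddE evenE)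
    then show False
    proof
      assume "i = j + 2 * l"
      moreover from this have "0 \<le> l" "l < k"
        using that \<open>\<not> j + 2 * k \<le> i\<close> by presburger+
      ultimately show False
        using that no_frames by metis
    next
      assume l: "i = j + 2 * l + 1"
      show False
      proof (cases "l = - 1")
        case True
        then show False
          using l that arc_to_root by simp
      next
        case False
        \<comment> \<open>This window ends in \<open>v_(j+2l+2)\<close>, as does the frame at
          \<open>i\<close>, so \<open>in_arc\<close> excludes the latter.\<close>
        then have "window n (j + 2 * l) \<in> parcs T"
          using l that \<open>\<not> j + 2 * k \<le> i\<close> k by (intro window_if_no_frames no_frames) auto
        then show False
          using in_arc[of "j + 2 * l + 2"] l that \<open>\<not> j + 2 * k \<le> i\<close> False k by (auto simp: algebra_simps)
      qed
    qed
  qed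
  ultimately show ?thesis
    using arc_to_root n_ge_2 k
    by (subst subset_square_cycle_iff[OF _ parcs_T, where b = "j - 1" and c = "j - 2"])
      (auto simp: frame_in_S_graph_iff window_in_S_graph_iff)
qed

text \<open>If no frame leaves the path of windows from the root, odd \<open>n\<close> gives
  \<open>2 * k = n - 1\<close>, while for even \<open>n\<close> the path would return to the
  root.\<close>

lemma subset_some_S_graph:
  obtains k where "0 \<le> k" "2 * k < int n" "parcs T \<subseteq> parcs (S_graph n k j)"
proof (cases "\<exists>i. 2 * int i < int n - 1 \<and> frame n (j + 2 * int i) \<in> parcs T")
  case True
  \<comment> \<open>The strict bound omits offset \<open>n - 1\<close>, whose frame would enter the
    root.\<close>
  define k where "k = (LEAST i. 2 * int i < int n - 1 \<and> frame n (j + 2 * int i) \<in> parcs T)"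
  have k: "2 * int k < int n - 1" "frame n (j + 2 * int k) \<in> parcs T"
    using LeastI_ex[OF True] unfolding k_def by auto
  have "frame n (j + 2 * l) \<notin> parcs T" if "0 \<le> l" "l < int k" for l
  proof -
    have "nat l < k"
      using that by auto
    from not_less_Least[OF this[unfolded k_def]] show ?thesis
      using that k(1) by auto
  qed
  then show ?thesis
    using k by (intro that[of "int k"] subset_S_graph_if_no_frames) auto
next
  case False
  have no_frames: "frame n (j + 2 * l) \<notin> parcs T" if "0 \<le> l" "2 * l < int n - 1" for l
    using False that by (metis int_nat_eq)
  show ?thesis
  proof (cases "odd n")
    case True
    then obtain m where "n = 2 * m + 1"
      by (rule oddE)
    then show ?thesis
      by (intro that[of "int m"] subset_S_graph_if_no_frames no_frames) auto
  next
    case False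
    then obtain m where m: "n = 2 * m"
      by (auto elim: evenE)
    then have "window n (j + 2 * (int m - 1)) \<in> parcs T"
      using n_ge by (intro window_if_no_frames no_frames) auto
    moreover have "window n (j + 2 * (int m - 1)) = window n (j - 2)"
      using m by (simp add: window_eq_iff vtx_eq_iff)
    ultimately show ?thesis
      using arc_to_root by simp
  qed
qed

context
  fixes k :: int
  assumes k: "0 \<le> k" "2 * k < int n"
    and T_S: "parcs T \<subseteq> parcs (S_graph n k j)"
begin

text \<open>The window into \<open>v_(j+2k+1)\<close> is removed, so that vertex must be entered by
  its frame. This starts the closure argument and also identifies \<open>k\<close>.\<close>

lemma first_frame:
  assumes "2 * k < int n - 1"
  shows "frame n (j + 2 * k) \<in> parcs T"
proof -
  have "window n (j + 2 * k - 1) \<notin> parcs T"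
    using T_S by (auto simp: S_graph_def)
  then show ?thesis
    using in_arc[of "j + 2 * k + 1"] assms k by auto
qed

lemma S_graph_subset_closed:
  assumes H: "closed_subgraph n H" "parcs T \<subseteq> parcs H"
  shows "parcs (S_graph n k j) \<subseteq> parcs H"
proof -
  \<comment> \<open>The arc of \<open>T\<close> entering \<open>v_(i+2)\<close> is the second known
    arc of the triangle at \<open>i\<close>.\<close>
  have chain: "frame n (i + 1) \<in> parcs H \<and> window n i \<in> parcs H"
    if "frame n i \<in> parcs H" "j - 1 \<le> i" "i + 2 < j + int n" for i
  proof -
    have "frame n (i + 1) \<in> parcs T \<or> window n i \<in> parcs T"
      using in_arc[of "i + 2"] that by (auto simp: algebra_simps)
    then show ?thesis
      using closed_subgraphD(1,2)[OF H(1) n_ge_2 that(1)] H(2) by blast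
  qed
  have F: "frame n i \<in> parcs H" if "j + 2 * k \<le> i" "i < j - 1 + int n" for i
    using that
  proof (induction i rule: int_ge_induct)
    case base
    then show ?case
      using first_frame H(2) by auto
  next
    case (step i)
    then show ?case
      using chain[of i] k by auto
  qed
  \<comment> \<open>Before \<open>j + 2 * k - 1\<close>, the frame with the same head as this window
    is removed, so \<open>T\<close> itself contains the window; from \<open>j + 2 * k\<close> on,
    \<open>chain\<close> provides it.\<close>
  have W: "window n i \<in> parcs H" if "j - 1 \<le> i" "i < j - 2 + int n" "i \<noteq> j + 2 * k - 1" for i
  proof (cases "j + 2 * k \<le> i")
    case True
    then show ?thesis
      using F[of i] chain[of i] that k by auto
  next
    case False
    then have "frame n (i + 1) \<notin> parcs T"
      using T_S frame_in_S_graph_iff[OF n_ge_2 k, of j "i + 1"] that by auto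
    then show ?thesis
      using in_arc[of "i + 2"] that H(2) by (auto simp: algebra_simps)
  qed
  show ?thesis
    using F W k n_ge
    by (subst subset_square_cycle_iff[OF _ S_graph_parcs_subset, where b = "j - 1" and c = "j - 2"])
      (auto simp: frame_in_S_graph_iff window_in_S_graph_iff)
qed

text \<open>Connectedness is inherited from the connected spanning subgraph
  \<open>T\<close>.\<close>

lemma nontrivial_wcsc_S_graph: "nontrivial_wcsc_subgraph n (S_graph n k j)"
proof -
  have "spanning (with_proj T) (with_proj (S_graph n k j))"
    using T_S pverts_T subset_trans[OF S_graph_parcs_subset square_cycle_wf, of n k j]
    by (simp add: spanning_with_proj_iff)
  then have "Digraph_Component.connected (with_proj (S_graph n k j))"
    using connected_T wf_digraph.connected_spanning_imp_connected
    by (metis spanning_def subgraph_def)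
  then show ?thesis
    using S_graph_closed[OF n_ge_2 k] S_graph_nontrivial[of n k j] S_graph_parcs_subset
    by (simp only: nontrivial_wcsc_subgraph_def wcsc_subgraph_def spanning_square_cycle_iff
        S_graph_pverts) blast
qed

text \<open>Such an \<open>H\<close> contains \<open>S_graph n k j\<close>, and containing it
  strictly would make \<open>H\<close> trivial.\<close>

lemma nontrivial_wcsc_above_tree:
  assumes "nontrivial_wcsc_subgraph n H" "parcs T \<subseteq> parcs H"
  shows "H = S_graph n k j"
proof -
  have H: "pverts H = range (vtx n)" "parcs H \<subseteq> parcs (square_cycle n)" "closed_subgraph n H"
      "H \<noteq> square_cycle n" "\<not> (odd n \<and> H = window_subgraph n)"
    using assms(1)
    unfolding nontrivial_wcsc_subgraph_def wcsc_subgraph_def spanning_square_cycle_iff by blast+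
  have "parcs H \<noteq> parcs (square_cycle n)" "\<not> (odd n \<and> parcs H = range (window n))"
    using H by (auto simp: window_subgraph_def)
  then have "parcs H = parcs (S_graph n k j)"
    using closed_above_S_graph_trivial[OF n_ge_2 k H(3) _ H(2)] S_graph_subset_closed[OF H(3) assms(2)]
    by blast
  with H(1) show ?thesis
    by simp
qed

end

end

section \<open>The range of \<open>k\<close>, and the decomposition of the set of trees\<close>

lemma le_ceiling_half_iff: "k \<le> \<lceil>(real n - 2) / 2\<rceil> \<longleftrightarrow> 2 * k < int n"
proof -
  \<comment> \<open>For an integer \<open>k\<close>, being at most the ceiling of \<open>x\<close>
    means \<open>k - 1 < x\<close>.\<close>
  have "k \<le> \<lceil>(real n - 2) / 2\<rceil> \<longleftrightarrow> real_of_int (2 * k) < real_of_int (int n)"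
    by (simp add: le_ceiling_iff field_simps)
  then show ?thesis
    by (simp only: of_int_less_iff)
qed

text \<open>Both graphs have the same vertices. Membership in the union thus becomes containment in
  some \<open>S_graph n k j\<close>.\<close>

lemma directed_spanning_trees_S_graph:
  "A \<in> directed_spanning_trees (S_graph n k j) u \<longleftrightarrow>
    A \<in> directed_spanning_trees (square_cycle n) u \<and> A \<subseteq> parcs (S_graph n k j)"
proof -
  have "directed_spanning_tree T (S_graph n k j) u \<longleftrightarrow>
      directed_spanning_tree T (square_cycle n) u \<and> parcs T \<subseteq> parcs (S_graph n k j)" for T
    using directed_spanning_tree_mono[OF _ _ S_graph_parcs_subset square_cycle_wf]
      directed_spanning_tree_subset[OF _ _ _ S_graph_parcs_subset]
    by (metis S_graph_pverts directed_spanning_tree_def spanning_tree_def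
        spanning_with_proj_iff square_cycle_simps(1))
  then show ?thesis
    by (auto simp: directed_spanning_trees_def)
qed

theorem theorem4p1:
  fixes n :: nat
  assumes "n \<ge> 5"
  shows "\<forall>j :: int.
    (\<forall>G. directed_spanning_tree G (square_cycle n) (vtx n j) \<longrightarrow>
      (\<exists>!H. nontrivial_wcsc_subgraph n H \<and> parcs G \<subseteq> parcs H) \<and>
      (\<forall>H. nontrivial_wcsc_subgraph n H \<and> parcs G \<subseteq> parcs H \<longrightarrow>
        (\<exists>k j'. 0 \<le> k \<and> k \<le> \<lceil>(real n - 2) / 2\<rceil> \<and> 0 \<le> j' \<and> j' \<le> int n - 1 \<and>
          H = S_graph n k j'))) \<and>
    directed_spanning_trees (square_cycle n) (vtx n j) =
      (\<Union>k \<in> {0 .. \<lceil>(real n - 2) / 2\<rceil>}. directed_spanning_trees (S_graph n k j) (vtx n j)) \<and>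
    disjoint_family_on (\<lambda>k. directed_spanning_trees (S_graph n k j) (vtx n j))
      {0 .. \<lceil>(real n - 2) / 2\<rceil>}"
proof (intro allI conjI impI)
  fix j G
  assume "directed_spanning_tree G (square_cycle n) (vtx n j)"
  then interpret square_cycle_tree n j G
    using assms by unfold_locales
  obtain k where k: "0 \<le> k" "2 * k < int n" "parcs G \<subseteq> parcs (S_graph n k j)"
    by (rule subset_some_S_graph)
  show "\<exists>!H. nontrivial_wcsc_subgraph n H \<and> parcs G \<subseteq> parcs H"
    using nontrivial_wcsc_S_graph[OF k] nontrivial_wcsc_above_tree[OF k] k(3) by blast
  fix H
  assume H: "nontrivial_wcsc_subgraph n H \<and> parcs G \<subseteq> parcs H"
  \<comment> \<open>Reducing \<open>j\<close> modulo \<open>n\<close> supplies the \<open>j'\<close>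
    in the required range.\<close>
  have "S_graph n k j = S_graph n k (j mod int n)"
    by (rule S_graph_vtx_cong) (simp add: vtx_def)
  then have "H = S_graph n k (j mod int n)"
    using nontrivial_wcsc_above_tree[OF k] H by simp
  moreover have "0 \<le> j mod int n" "j mod int n \<le> int n - 1"
    using assms by simp_all
  ultimately show "\<exists>k j'. 0 \<le> k \<and> k \<le> \<lceil>(real n - 2) / 2\<rceil> \<and> 0 \<le> j' \<and> j' \<le> int n - 1 \<and>
      H = S_graph n k j'"
    using k le_ceiling_half_iff by blast
next
  fix j
  show "directed_spanning_trees (square_cycle n) (vtx n j) =
      (\<Union>k \<in> {0 .. \<lceil>(real n - 2) / 2\<rceil>}. directed_spanning_trees (S_graph n k j) (vtx n j))"
  proof (intro subset_antisym subsetI)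
    fix A
    assume A: "A \<in> directed_spanning_trees (square_cycle n) (vtx n j)"
    then obtain T where T: "directed_spanning_tree T (square_cycle n) (vtx n j)" "A = parcs T"
      by (auto simp: directed_spanning_trees_def)
    then interpret square_cycle_tree n j T
      using assms by unfold_locales
    obtain k where "0 \<le> k" "2 * k < int n" "parcs T \<subseteq> parcs (S_graph n k j)"
      by (rule subset_some_S_graph)
    then show "A \<in> (\<Union>k \<in> {0 .. \<lceil>(real n - 2) / 2\<rceil>}. directed_spanning_trees (S_graph n k j) (vtx n j))"
      using A T(2) directed_spanning_trees_S_graph by (auto simp: le_ceiling_half_iff)
  qed (use directed_spanning_trees_S_graph in auto)
next
  fix j
  have disj: False
    if kl: "0 \<le> k" "k < l" "2 * l < int n"
      and A: "A \<in> directed_spanning_trees (S_graph n k j) (vtx n j)"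
        "A \<in> directed_spanning_trees (S_graph n l j) (vtx n j)" for k l A
  proof -
    obtain T where T: "directed_spanning_tree T (square_cycle n) (vtx n j)" "A = parcs T"
      and sub: "parcs T \<subseteq> parcs (S_graph n k j)" "parcs T \<subseteq> parcs (S_graph n l j)"
      using A directed_spanning_trees_S_graph by (auto simp: directed_spanning_trees_def)
    then interpret square_cycle_tree n j T
      using assms by unfold_locales
    \<comment> \<open>From \<open>k < l\<close> and \<open>2 * l < n\<close> follows
      \<open>2 * k < n - 1\<close>; the same frame is among those removed for
      \<open>l\<close>.\<close>
    have "frame n (j + 2 * k) \<in> parcs T"
      using kl sub(1) by (intro first_frame) auto
    then show False
      using sub(2) kl frame_in_S_graph_iff[OF n_ge_2, of l j "j + 2 * k"] by auto
  qed
  show "disjoint_family_on (\<lambda>k. directed_spanning_trees (S_graph n k j) (vtx n j))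
      {0 .. \<lceil>(real n - 2) / 2\<rceil>}"
    unfolding disjoint_family_on_def
  proof (intro ballI impI)
    fix k l
    assume "k \<in> {0 .. \<lceil>(real n - 2) / 2\<rceil>}" "l \<in> {0 .. \<lceil>(real n - 2) / 2\<rceil>}" "k \<noteq> l"
    then show "directed_spanning_trees (S_graph n k j) (vtx n j) \<inter>
        directed_spanning_trees (S_graph n l j) (vtx n j) = {}"
      using disj[of k l] disj[of l k] by (cases "k < l") (auto simp: le_ceiling_half_iff)
  qed
qed

end
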